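(* Let $f:[0,1]\to[0,1]$ be a mixing continuous map, and let $A=A(f)$ be the set of those of the points $0,1$ which have no preimages in $(0,1)$ under the iterates $f^n$, $n\ge1$. Then there are the following possibilities for $A$: 1) $A=\emptyset$; 2) $A=\{0\}$, $f(0)=0$; 3) $A=\{1\}$, $f(1)=1$; 4) $A=\{0,1\}$, $f(0)=0$, $f(1)=1$; 5) $A=\{0,1\}$, $f(0)=1$, $f(1)=0$. Moreover, if $I\subset[0,1]$ is a closed interval with $I\cap A=\emptyset$, then for any nonempty open $U\subset[0,1]$ there exists $n$ such that $f^mU\supset I$ for all $m>n$ (in particular, if $A=\emptyset$ then for any nonempty open $U$ there exists $n$ such that $f^nU=[0,1]$).
   Context: A continuous map $T:X\to X$ of a compact metric space is mixing if for any nonempty open $U,V$ there is $N$ with $T^nU\cap V\ne\emptyset$ for all $n>N$. *)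

theory Defs
  imports "HOL-Analysis.Analysis"
begin

text \<open>
  A compact metric space is given by a compact subset \<open>X\<close> of a metric type, and a self-map of it
  by a function mapping \<open>X\<close> into \<open>X\<close>. Only the topological mixing condition is part of the
  definition below; compactness of \<open>X\<close>, continuity of \<open>T\<close> on \<open>X\<close> and \<open>T ` X \<subseteq> X\<close> are to be
  assumed separately. Open sets are the relatively open subsets of \<open>X\<close>.
\<close>

definition mixing_on :: "'a::metric_space set \<Rightarrow> ('a \<Rightarrow> 'a) \<Rightarrow> bool" where
  "mixing_on X T \<longleftrightarrow>
    (\<forall>U V. openin (top_of_set X) U \<and> U \<noteq> {} \<and> openin (top_of_set X) V \<and> V \<noteq> {} \<longrightarrow>
      (\<exists>N. \<forall>n>N. (T ^^ n) ` U \<inter> V \<noteq> {}))"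

definition exceptional_endpoints :: "(real \<Rightarrow> real) \<Rightarrow> real set" where
  "exceptional_endpoints f =
    {x \<in> {0, 1}. \<forall>n\<ge>1. (f ^^ n) -` {x} \<inter> {0<..<1} = {}}"

end

theory Submission
  imports Defs
begin

text \<open>
  Since a mixing map is surjective, an exceptional endpoint can only have endpoints as preimages,
  which leaves the listed cases. For a relatively open interval \<open>J\<close>, mixing makes the connected
  set \<open>f\<^sup>n J\<close> meet both sides of any \<open>p \<in> (0,1)\<close>, hence contain \<open>p\<close>, for all large \<open>n\<close>; pushing
  forward by a fixed iterate extends this to non-exceptional endpoints, and connectedness fills in
  the interval between two such points.
\<close>

lemma funpow_image_subset:
  assumes "f ` S \<subseteq> S"
  shows "(f ^^ n) ` S \<subseteq> S"
  using assms by (induction n) auto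

lemma continuous_on_funpow:
  assumes "continuous_on S f" and "f ` S \<subseteq> S"
  shows "continuous_on S (f ^^ n)"
proof (induction n)
  case 0
  then show ?case by simp
next
  case (Suc n)
  have "continuous_on ((f ^^ n) ` S) f"
    using continuous_on_subset[OF assms(1) funpow_image_subset[OF assms(2)]] .
  with Suc show ?case by (simp add: continuous_on_compose del: o_apply)
qed

lemma connected_funpow_image:
  assumes "continuous_on S f" and "f ` S \<subseteq> S" and "J \<subseteq> S" and "connected J"
  shows "connected ((f ^^ n) ` J)"
  using connected_continuous_image[OF continuous_on_subset[OF continuous_on_funpow]] assms .

text \<open>Every iterate of positive order has its image inside \<open>f\<close>
  X\<open>, so mixing applied with all of\<close>X\<open>as the source set already forces\<close>f
  \<open>X\<close> to meet \<open>V\<close>.\<close>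

lemma mixing_on_image_dense:
  assumes "mixing_on X f" and "f ` X \<subseteq> X" and "openin (top_of_set X) V" and "V \<noteq> {}"
  shows "f ` X \<inter> V \<noteq> {}"
proof -
  have "X \<noteq> {}"
    using openin_subset[OF assms(3)] assms(4) by auto
  then obtain N where "\<forall>n>N. (f ^^ n) ` X \<inter> V \<noteq> {}"
    using assms(1,3,4) unfolding mixing_on_def by (metis openin_subtopology_self)
  \<comment> \<open>\<open>Suc N\<close> exceeds \<open>N\<close> and is also positive, so
    \<open>f\<close> can be split off as the last map applied.\<close>
  then have "(f ^^ Suc N) ` X \<inter> V \<noteq> {}"
    by blast
  moreover have "(f ^^ Suc N) ` X \<subseteq> f ` X"
    using funpow_image_subset[OF assms(2), of N] by auto
  ultimately show ?thesis by blast
qed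

text \<open>The image is compact, hence closed; if it were proper, its complement would be a
  nonempty open set that the dense image misses.\<close>

lemma mixing_on_surj:
  assumes "continuous_on X f" and "compact X" and "f ` X \<subseteq> X" and "mixing_on X f"
  shows "f ` X = X"
proof (rule ccontr)
  assume "f ` X \<noteq> X"
  then have "X - f ` X \<noteq> {}"
    using assms(3) by blast
  moreover have "closed (f ` X)"
    by (simp add: assms(1,2) compact_continuous_image compact_imp_closed)
  then have "openin (top_of_set X) (X - f ` X)"
    by (simp add: Diff_eq open_Compl openin_open_Int)
  ultimately show False
    using mixing_on_image_dense[OF assms(4,3)] by blast
qed

lemma exceptional_endpoints_subset: "exceptional_endpoints f \<subseteq> {0, 1}"
  unfolding exceptional_endpoints_def by auto

text \<open>An interior point that reached \<open>y\<close> in \<open>n\<close> steps would reach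
  \<open>f y\<close> in \<open>n + 1\<close> steps.\<close>

lemma exceptional_endpoints_backward:
  assumes "f y \<in> exceptional_endpoints f" and "y \<in> {0, 1}"
  shows "y \<in> exceptional_endpoints f"
proof -
  have "(f ^^ n) x \<noteq> y" if "n \<ge> 1" and "x \<in> {0<..<1}" for n x
  proof
    assume "(f ^^ n) x = y"
    then have "(f ^^ Suc n) x = f y"
      by simp
    moreover have "\<And>m. m \<ge> 1 \<Longrightarrow> (f ^^ m) x \<noteq> f y"
      using assms(1) that(2) unfolding exceptional_endpoints_def by blast
    ultimately show False
      using that(1) by (metis le_SucI)
  qed
  then show ?thesis
    using assms(2) unfolding exceptional_endpoints_def by blast
qed

text \<open>This yields A \<subseteq> f(A) for the exceptional set A; since A is finite,
  \<open>f\<close> then permutes it. An interior preimage is excluded by the case n = 1 of the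
  definition, so any preimage is an endpoint, and exceptionality passes back to it.\<close>

lemma exceptional_endpoint_preimage:
  assumes "f ` {0..1} = {0..1}" and "e \<in> exceptional_endpoints f"
  obtains y where "y \<in> exceptional_endpoints f" and "f y = e"
proof -
  have "e \<in> {0..1}"
    using assms(2) exceptional_endpoints_subset[of f] by auto
  then obtain y where y: "y \<in> {0..1}" "f y = e"
    using assms(1) by (metis imageE)
  have "y \<notin> {0<..<1}"
  proof
    assume "y \<in> {0<..<1}"
    moreover have "(f ^^ 1) y = e"
      using y by simp
    ultimately show False
      using assms(2) unfolding exceptional_endpoints_def by blast
  qed
  then have "y \<in> {0, 1}"
    using y(1) by auto
  then show thesis
    using that y(2) assms(2) exceptional_endpoints_backward by blast
qed

lemma eventually_mem_funpow_image:
  fixes f :: "real \<Rightarrow> real"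
  assumes cont: "continuous_on {0..1} f" and ran: "f ` {0..1} \<subseteq> {0..1}"
    and mix: "mixing_on {0..1} f"
    and J: "openin (top_of_set {0..1}) J" "J \<noteq> {}" "connected J"
    and p: "p \<in> {0..1} - exceptional_endpoints f"
  shows "\<forall>\<^sub>F n in sequentially. p \<in> (f ^^ n) ` J"
proof -
  have JX: "J \<subseteq> {0..1}"
    using J(1) by (rule openin_imp_subset)
  have inner: "\<forall>\<^sub>F n in sequentially. q \<in> (f ^^ n) ` J" if q: "q \<in> {0<..<1}" for q
  proof -
    have meets: "\<forall>\<^sub>F n in sequentially. (f ^^ n) ` J \<inter> V \<noteq> {}"
      if "openin (top_of_set {0..1}) V" "V \<noteq> {}" for V
      using mix J(1,2) that unfolding mixing_on_def eventually_at_top_dense by blast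
    \<comment> \<open>The endpoints witness that both sides of an interior \<open>q\<close> are
      nonempty, so mixing applies to each.\<close>
    have "0 \<in> {0..1} \<inter> {..<q}" and "1 \<in> {0..1} \<inter> {q<..}"
      using q by auto
    then have "{0..1} \<inter> {..<q} \<noteq> {}" and "{0..1} \<inter> {q<..} \<noteq> {}"
      by blast+
    then have "\<forall>\<^sub>F n in sequentially. (f ^^ n) ` J \<inter> ({0..1} \<inter> {..<q}) \<noteq> {}
        \<and> (f ^^ n) ` J \<inter> ({0..1} \<inter> {q<..}) \<noteq> {}"
      by (intro eventually_conj meets openin_open_Int open_lessThan open_greaterThan)
    then show ?thesis
    proof eventually_elim
      case (elim n)
      then obtain u v where uv: "u \<in> (f ^^ n) ` J" "v \<in> (f ^^ n) ` J" "u < q" "q < v"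
        by blast
      from connected_contains_Icc[OF connected_funpow_image[OF cont ran JX J(3)] uv(1,2)] show ?case
        using uv(3,4) by auto
    qed
  qed
  show ?thesis
  proof (cases "p \<in> {0<..<1}")
    case True
    then show ?thesis by (rule inner)
  next
    case False
    then have "p \<in> {0, 1}"
      using p by auto
    then obtain k x where kx: "x \<in> {0<..<1}" "(f ^^ k) x = p"
      using p unfolding exceptional_endpoints_def by blast
    \<comment> \<open>The interior point \<open>x\<close> lies in the \<open>n\<close>-th image for
      all large \<open>n\<close>, and \<open>k\<close> further steps carry it to \<open>p\<close>.
      The shift by the fixed \<open>k\<close> does not affect an eventual statement.\<close>
    have "\<forall>\<^sub>F n in sequentially. p \<in> (f ^^ (n + k)) ` J"
      using inner[OF kx(1)]
    proof eventually_elim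
      case (elim n)
      then have "(f ^^ k) x \<in> (f ^^ k) ` (f ^^ n) ` J"
        by blast
      then show ?case
        using kx(2) by (simp add: image_comp add.commute[of n] funpow_add)
    qed
    then show ?thesis
      by (simp add: eventually_sequentially_seg[of "\<lambda>n. p \<in> (f ^^ n) ` J"])
  qed
qed

lemma eventually_Icc_subset_funpow_image:
  fixes f :: "real \<Rightarrow> real"
  assumes cont: "continuous_on {0..1} f" and ran: "f ` {0..1} \<subseteq> {0..1}"
    and mix: "mixing_on {0..1} f"
    and U: "openin (top_of_set {0..1}) U" "U \<noteq> {}"
    and ab: "a \<in> {0..1} - exceptional_endpoints f" "b \<in> {0..1} - exceptional_endpoints f"
  shows "\<forall>\<^sub>F n in sequentially. {a..b} \<subseteq> (f ^^ n) ` U"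
proof -
  obtain x where x: "x \<in> U"
    using U(2) by blast
  obtain W where W: "open W" "U = {0..1} \<inter> W"
    using U(1) by (auto simp: openin_open)
  then obtain e where e: "e > 0" "ball x e \<subseteq> W"
    using x open_contains_ball by blast
  \<comment> \<open>\<open>U\<close> may be disconnected, so it is shrunk to a convex, relatively
    open piece around \<open>x\<close>.\<close>
  define J where "J = {0..1} \<inter> ball x e"
  have JU: "J \<subseteq> U"
    unfolding J_def W(2) using e(2) by blast
  have J: "openin (top_of_set {0..1}) J" "J \<noteq> {}" "connected J"
    using x e(1) W(2) unfolding J_def
    by (auto intro!: openin_open_Int convex_connected convex_Int exI[of _ x])
  have "\<forall>\<^sub>F n in sequentially. a \<in> (f ^^ n) ` J \<and> b \<in> (f ^^ n) ` J"
    using eventually_mem_funpow_image[OF cont ran mix J] ab by (intro eventually_conj)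
  then show ?thesis
  proof eventually_elim
    case (elim n)
    have "connected ((f ^^ n) ` J)"
      using connected_funpow_image[OF cont ran openin_imp_subset[OF J(1)] J(3)] .
    then have "{a..b} \<subseteq> (f ^^ n) ` J"
      using elim connected_contains_Icc by blast
    then show ?case
      using JU by blast
  qed
qed

theorem lemma8p5:
  fixes f :: "real \<Rightarrow> real" and A :: "real set"
  assumes "continuous_on {0..1} f"
    and "f ` {0..1} \<subseteq> {0..1}"
    and "mixing_on {0..1} f"
    and "A = exceptional_endpoints f"
  shows "(A = {} \<or>
          (A = {0} \<and> f 0 = 0) \<or>
          (A = {1} \<and> f 1 = 1) \<or>
          (A = {0, 1} \<and> f 0 = 0 \<and> f 1 = 1) \<or>
          (A = {0, 1} \<and> f 0 = 1 \<and> f 1 = 0)) \<and>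
         (\<forall>a b U. a \<le> b \<and> {a..b} \<subseteq> {0..1} \<and> {a..b} \<inter> A = {} \<and>
            openin (top_of_set {0..1}) U \<and> U \<noteq> {} \<longrightarrow>
            (\<exists>n. \<forall>m>n. {a..b} \<subseteq> (f ^^ m) ` U)) \<and>
         (A = {} \<longrightarrow>
            (\<forall>U. openin (top_of_set {0..1}) U \<and> U \<noteq> {} \<longrightarrow>
              (\<exists>n. (f ^^ n) ` U = {0..1})))"
proof (intro conjI allI impI)
  have pre: "\<exists>y\<in>A. f y = e" if "e \<in> A" for e
    using exceptional_endpoint_preimage[OF mixing_on_surj[OF assms(1) compact_Icc assms(2,3)]]
      that assms(4) by metis
  have "A \<subseteq> {0, 1}"
    using assms(4) exceptional_endpoints_subset by simp
  then consider "A = {}" | "A = {0}" | "A = {1}" | "A = {0, 1}"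
    by blast
  then show "A = {} \<or>
          (A = {0} \<and> f 0 = 0) \<or>
          (A = {1} \<and> f 1 = 1) \<or>
          (A = {0, 1} \<and> f 0 = 0 \<and> f 1 = 1) \<or>
          (A = {0, 1} \<and> f 0 = 1 \<and> f 1 = 0)"
    \<comment> \<open>A permutation of a singleton fixes its point; on two endpoints it is the
      identity or the swap.\<close>
    by cases (use pre[of 0] pre[of 1] in auto)
next
  fix a b :: real and U :: "real set"
  assume *: "a \<le> b \<and> {a..b} \<subseteq> {0..1} \<and> {a..b} \<inter> A = {} \<and>
            openin (top_of_set {0..1}) U \<and> U \<noteq> {}"
  \<comment> \<open>As \<open>{a..b}\<close> avoids \<open>A\<close>, its own two ends are not
    exceptional.\<close>
  then have "a \<in> {a..b}" "b \<in> {a..b}"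
    by auto
  then have "a \<in> {0..1} - exceptional_endpoints f" "b \<in> {0..1} - exceptional_endpoints f"
    using * assms(4) by blast+
  with * show "\<exists>n. \<forall>m>n. {a..b} \<subseteq> (f ^^ m) ` U"
    using eventually_Icc_subset_funpow_image[OF assms(1-3)]
    unfolding eventually_at_top_dense by blast
next
  fix U :: "real set"
  assume "A = {}" and U: "openin (top_of_set {0..1}) U \<and> U \<noteq> {}"
  then have "\<forall>\<^sub>F n in sequentially. {0..1} \<subseteq> (f ^^ n) ` U"
    using assms(4) by (intro eventually_Icc_subset_funpow_image[OF assms(1-3)]) auto
  then obtain n where "{0..1} \<subseteq> (f ^^ n) ` U"
    using eventually_happens sequentially_bot by blast
  moreover have "(f ^^ n) ` U \<subseteq> {0..1}"
    using funpow_image_subset[OF assms(2)] openin_imp_subset U by blast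
  ultimately show "\<exists>n. (f ^^ n) ` U = {0..1}"
    by blast
qed

end
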